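(* Let $\mathcal{H}\neq\{0\}$ be a separable Hilbert space, $I$ a countable index set, and $\varphi=\{\varphi_i\}_{i\in I}$ a redundant frame for $\mathcal{H}$ with frame bounds $0<A_\varphi\le B_\varphi<\infty$ and frame operator $S_\varphi$. Suppose there exists a bounded operator $T\in B(\mathcal{H})$ such that $$\Vert I_{\mathcal{H}}-T\Vert<1,\qquad \Vert I_{\mathcal{H}}-T^*S_\varphi^{-1}\Vert^2<\frac{A_\varphi}{B_\varphi}.$$ Then there are infinitely many approximate dual frames $\{\psi_i\}_{i\in I}$ of $\varphi$ such that $\{\varphi_i\}_{i\in I}$ and $\{\psi_i\}_{i\in I}$ are woven.
   Context: A family $\{\varphi_i\}_{i\in I}$ in $\mathcal{H}$ is a frame with frame bounds $0<A_\varphi\le B_\varphi<\infty$ if $A_\varphi\Vert f\Vert^2\le\sum_{i\in I}|\langle f,\varphi_i\rangle|^2\le B_\varphi\Vert f\Vert^2$ for all $f\in\mathcal{H}$; it is a Bessel sequence if the upper inequality holds for some finite bound. The synthesis operator of a Bessel sequence is $T_\varphi:\ell^2(I)\to\mathcal{H}$, $T_\varphi\{c_i\}=\sum_i c_i\varphi_i$, with adjoint $T_\varphi^*f=\{\langle f,\varphi_i\rangle\}_{i\in I}$, and the frame operator is $S_\varphi=T_\varphi T_\varphi^*$. A frame is redundant if it is not a Riesz basis; equivalently, $\ker T_\varphi\neq\{0\}$. A Bessel sequence $\psi=\{\psi_i\}_{i\in I}$ is an approximate dual frame of $\varphi$ if $\Vert I_{\mathcal{H}}-T_\psi T_\varphi^*\Vert<1$.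 Two frames $\{\varphi_i\}_{i\in I}$ and $\{\psi_i\}_{i\in I}$ are woven if there are constants $0<A\le B<\infty$ such that for every $J\subseteq I$ the family $\{\varphi_i\}_{i\in J}\cup\{\psi_i\}_{i\in J^c}$ (with $J^c=I\setminus J$, counted with indices) is a frame for $\mathcal{H}$ with bounds $A$ and $B$. $I_{\mathcal{H}}$ is the identity operator on $\mathcal{H}$. *)

theory Defs
  imports "HOL-Analysis.Analysis"
begin

(* The scalar field is real or complex. The axioms leave no other models: z is a root of
   X^2 - (z + conj z) X + |z|^2, whose coefficients are real because (1 + z) * conj (1 + z)
   is real, so the field has degree at most 2 over the reals; the last axiom then forces
   scalar_conj to be the identity, respectively complex conjugation. *)
class hilbert_scalar = real_normed_field +
  fixes scalar_conj :: "'a \<Rightarrow> 'a"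
  assumes scalar_conj_add: "scalar_conj (x + y) = scalar_conj x + scalar_conj y"
    and scalar_conj_mult: "scalar_conj (x * y) = scalar_conj x * scalar_conj y"
    and scalar_conj_scaleR_one: "scalar_conj (r *\<^sub>R 1) = r *\<^sub>R 1"
    and mult_scalar_conj: "z * scalar_conj z = (norm z)\<^sup>2 *\<^sub>R 1"

instantiation real :: hilbert_scalar
begin
definition scalar_conj_real :: "real \<Rightarrow> real" where "scalar_conj_real x = x"
instance
  by standard (simp_all add: scalar_conj_real_def power2_eq_square)
end

instantiation complex :: hilbert_scalar
begin
definition scalar_conj_complex :: "complex \<Rightarrow> complex" where "scalar_conj_complex z = cnj z"
instance
  by standard (simp_all add: scalar_conj_complex_def complex_norm_square scaleR_conv_of_real
      flip: of_real_power)
end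

(* The type is a Banach space (complete real normed space); the locale equips it with
   scalars from 'k and an inner product, linear in the first argument, inducing its norm. *)
locale hilbert_space = vector_space smul
  for smul :: "'k::hilbert_scalar \<Rightarrow> 'a::banach \<Rightarrow> 'a" +
  fixes ip :: "'a \<Rightarrow> 'a \<Rightarrow> 'k"
  assumes smul_of_real: "smul (of_real r) x = r *\<^sub>R x"
    and ip_add_left: "ip (x + y) z = ip x z + ip y z"
    and ip_smul_left: "ip (smul c x) y = c * ip x y"
    and ip_commute: "ip x y = scalar_conj (ip y x)"
    and ip_self: "ip x x = of_real ((norm x)\<^sup>2)"

lemma hilbert_space_real:
  "hilbert_space (scaleR :: real \<Rightarrow> 'a::{real_inner,banach} \<Rightarrow> 'a) inner"
  by unfold_locales
    (simp_all add: scalar_conj_real_def inner_add_left inner_commute power2_norm_eq_inner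
      algebra_simps)

lemma hilbert_space_complex:
  "hilbert_space ((*) :: complex \<Rightarrow> complex \<Rightarrow> complex) (\<lambda>x y. x * cnj y)"
  by unfold_locales
    (simp_all add: scalar_conj_complex_def complex_norm_square scaleR_conv_of_real algebra_simps
      flip: of_real_power)

definition bounded_operator ::
    "('k::hilbert_scalar \<Rightarrow> 'a::banach \<Rightarrow> 'a) \<Rightarrow> ('a \<Rightarrow> 'a) \<Rightarrow> bool" where
  "bounded_operator smul T \<longleftrightarrow> Vector_Spaces.linear smul smul T \<and> bounded_linear T"

definition hilbert_adjoint :: "('a \<Rightarrow> 'a \<Rightarrow> 'k) \<Rightarrow> ('a \<Rightarrow> 'a) \<Rightarrow> 'a \<Rightarrow> 'a" where
  "hilbert_adjoint ip T = (THE T'. \<forall>x y. ip (T x) y = ip x (T' y))"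

(* Summability is stated explicitly because infsum is 0 on a non-summable family;
   the series has nonnegative terms and a finite upper bound. *)
definition bessel_sequence ::
    "('a::banach \<Rightarrow> 'a \<Rightarrow> 'k::hilbert_scalar) \<Rightarrow> ('i \<Rightarrow> 'a) \<Rightarrow> bool" where
  "bessel_sequence ip \<phi> \<longleftrightarrow>
     (\<exists>B. \<forall>f. (\<lambda>i. (norm (ip f (\<phi> i)))\<^sup>2) summable_on UNIV \<and>
               (\<Sum>\<^sub>\<infinity>i. (norm (ip f (\<phi> i)))\<^sup>2) \<le> B * (norm f)\<^sup>2)"

definition frame_with_bounds ::
    "('a::banach \<Rightarrow> 'a \<Rightarrow> 'k::hilbert_scalar) \<Rightarrow> real \<Rightarrow> real \<Rightarrow> ('i \<Rightarrow> 'a) \<Rightarrow> bool" where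
  "frame_with_bounds ip A B \<phi> \<longleftrightarrow>
     0 < A \<and> A \<le> B \<and>
     (\<forall>f. (\<lambda>i. (norm (ip f (\<phi> i)))\<^sup>2) summable_on UNIV \<and>
          A * (norm f)\<^sup>2 \<le> (\<Sum>\<^sub>\<infinity>i. (norm (ip f (\<phi> i)))\<^sup>2) \<and>
          (\<Sum>\<^sub>\<infinity>i. (norm (ip f (\<phi> i)))\<^sup>2) \<le> B * (norm f)\<^sup>2)"

(* Meaningful for Bessel sequences and square-summable c, where the series converges
   unconditionally in norm. *)
definition synthesis ::
    "('k::hilbert_scalar \<Rightarrow> 'a::banach \<Rightarrow> 'a) \<Rightarrow> ('i \<Rightarrow> 'a) \<Rightarrow> ('i \<Rightarrow> 'k) \<Rightarrow> 'a" where
  "synthesis smul \<phi> c = (\<Sum>\<^sub>\<infinity>i. smul (c i) (\<phi> i))"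

(* The adjoint of the synthesis operator, given by its explicit formula. *)
definition analysis :: "('a \<Rightarrow> 'a \<Rightarrow> 'k) \<Rightarrow> ('i \<Rightarrow> 'a) \<Rightarrow> 'a \<Rightarrow> 'i \<Rightarrow> 'k" where
  "analysis ip \<phi> f = (\<lambda>i. ip f (\<phi> i))"

definition frame_operator ::
    "('k::hilbert_scalar \<Rightarrow> 'a::banach \<Rightarrow> 'a) \<Rightarrow> ('a \<Rightarrow> 'a \<Rightarrow> 'k) \<Rightarrow> ('i \<Rightarrow> 'a) \<Rightarrow> 'a \<Rightarrow> 'a" where
  "frame_operator smul ip \<phi> f = synthesis smul \<phi> (analysis ip \<phi> f)"

(* Complete, with two-sided l2 estimates for all finite linear combinations. *)
definition riesz_basis ::
    "('k::hilbert_scalar \<Rightarrow> 'a::banach \<Rightarrow> 'a) \<Rightarrow> ('i \<Rightarrow> 'a) \<Rightarrow> bool" where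
  "riesz_basis smul \<phi> \<longleftrightarrow>
     closure (module.span smul (range \<phi>)) = UNIV \<and>
     (\<exists>A B. 0 < A \<and> A \<le> B \<and>
        (\<forall>F c. finite F \<longrightarrow>
           A * (\<Sum>i\<in>F. (norm (c i))\<^sup>2) \<le> (norm (\<Sum>i\<in>F. smul (c i) (\<phi> i)))\<^sup>2 \<and>
           (norm (\<Sum>i\<in>F. smul (c i) (\<phi> i)))\<^sup>2 \<le> B * (\<Sum>i\<in>F. (norm (c i))\<^sup>2)))"

definition redundant_frame_with_bounds ::
    "('k::hilbert_scalar \<Rightarrow> 'a::banach \<Rightarrow> 'a) \<Rightarrow> ('a \<Rightarrow> 'a \<Rightarrow> 'k) \<Rightarrow> real \<Rightarrow> real \<Rightarrow> ('i \<Rightarrow> 'a) \<Rightarrow> bool"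
  where
  "redundant_frame_with_bounds smul ip A B \<phi> \<longleftrightarrow>
     frame_with_bounds ip A B \<phi> \<and> \<not> riesz_basis smul \<phi>"

definition approximate_dual ::
    "('k::hilbert_scalar \<Rightarrow> 'a::banach \<Rightarrow> 'a) \<Rightarrow> ('a \<Rightarrow> 'a \<Rightarrow> 'k) \<Rightarrow> ('i \<Rightarrow> 'a) \<Rightarrow> ('i \<Rightarrow> 'a) \<Rightarrow> bool"
  where
  "approximate_dual smul ip \<phi> \<psi> \<longleftrightarrow>
     bessel_sequence ip \<psi> \<and>
     onorm (\<lambda>f. f - synthesis smul \<psi> (analysis ip \<phi> f)) < 1"

(* J = UNIV and J = {} say that the two families are themselves frames. *)
definition woven ::
    "('a::banach \<Rightarrow> 'a \<Rightarrow> 'k::hilbert_scalar) \<Rightarrow> ('i \<Rightarrow> 'a) \<Rightarrow> ('i \<Rightarrow> 'a) \<Rightarrow> bool" where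
  "woven ip \<phi> \<psi> \<longleftrightarrow>
     (\<exists>A B. \<forall>J. frame_with_bounds ip A B (\<lambda>i. if i \<in> J then \<phi> i else \<psi> i))"

end

(* With V = T* S^{-1} and psi_i = V phi_i, the operator T_psi T_phi* is T*, and phi - psi is a
   Bessel sequence with bound ||I - V||^2 B < A, which forces phi and psi to be woven. Both
   estimates survive the replacement of V by c V for c < 1 close to 1, and this gives infinitely
   many families. *)
theory Submission
  imports Defs
begin

text \<open>The carrier is a Banach space with an abstract scalar-valued form, so inverse and
  adjoint are constructed: the inverse of S from the contraction I - S/B, and T* from the frame
  expansion. Infinite series are kept out of the estimates as long as possible: Bessel bounds speak
  of finite sums, and a suitable finite test vector leads to an inequality s^2 <= K s. For the
  scaled families, I - c V = c (I - V) + (1 - c) I, so strictness in both hypotheses leaves room for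
  an interval of values c. The families for different c differ because their operators c T* do: ||I
  - T*|| < 1 and H nonzero make T* nonzero.\<close>

text \<open>Off a finite set that nearly exhausts the sum of \<open>u\<close>, every finite sum of
  \<open>g\<close> is small, so the net of finite sums is Cauchy and completeness gives the
  limit.\<close>

lemma summable_on_of_norm_sum_bound:
  fixes g :: "'i \<Rightarrow> 'a::banach" and u :: "'i \<Rightarrow> real"
  assumes u: "u summable_on UNIV" and u_nonneg: "\<And>i. 0 \<le> u i"
    and le: "\<And>F. finite F \<Longrightarrow> (norm (sum g F))\<^sup>2 \<le> B * sum u F"
  shows "g summable_on UNIV"
proof -
  \<comment> \<open>\<open>B\<close> may be negative or 0; as \<open>u\<close> is nonnegative, it
    can be raised to a positive constant, by which one may divide.\<close>
  define K where "K = max B 1"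
  have "K > 0" by (simp add: K_def)
  have leK: "(norm (sum g F))\<^sup>2 \<le> K * sum u F" if "finite F" for F
  proof -
    have "B * sum u F \<le> K * sum u F"
      by (rule mult_right_mono) (auto simp: K_def u_nonneg sum_nonneg)
    then show ?thesis using le[OF that] by simp
  qed
  have "\<exists>P. eventually P (finite_subsets_at_top UNIV) \<and>
            (\<forall>F F'. P F \<and> P F' \<longrightarrow> dist (sum g F) (sum g F') < e)" if "e > 0" for e
  proof -
    \<comment> \<open>Makes \<open>K * d\<close> the square of \<open>e/3\<close>; two finite sums
      past \<open>F0\<close> are then at distance at most \<open>2 * e / 3\<close>.\<close>
    define d where "d = (e/3)\<^sup>2 / K"
    have "d > 0" using \<open>e > 0\<close> \<open>K > 0\<close> by (simp add: d_def)
    obtain F0 where F0: "finite F0" "dist (sum u F0) (infsum u UNIV) \<le> d"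
      using infsum_finite_approximation[OF u \<open>d > 0\<close>] by blast
    have near: "dist (sum g F) (sum g F0) \<le> e/3" if "finite F" "F0 \<subseteq> F" for F
    proof -
      have "sum u F \<le> infsum u UNIV"
        using finite_sum_le_infsum[OF u] that u_nonneg by auto
      moreover have "sum u (F - F0) = sum u F - sum u F0"
        using that by (simp add: sum_diff)
      ultimately have "sum u (F - F0) \<le> d" using F0(2) by (simp add: dist_real_def)
      then have "K * sum u (F - F0) \<le> K * d" using \<open>K > 0\<close> by simp
      also have "K * d = (e/3)\<^sup>2" using \<open>K > 0\<close> by (simp add: d_def)
      finally have "(norm (sum g (F - F0)))\<^sup>2 \<le> (e/3)\<^sup>2"
        using leK[of "F - F0"] that by simp
      then have "norm (sum g (F - F0)) \<le> e/3"
        using \<open>e > 0\<close> by (simp add: power2_le_iff_abs_le)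
      then show ?thesis using that by (simp add: dist_norm sum_diff)
    qed
    show ?thesis
    proof (intro exI conjI allI impI)
      show "eventually (\<lambda>F. finite F \<and> F0 \<subseteq> F) (finite_subsets_at_top UNIV)"
        using F0(1) by (auto simp: eventually_finite_subsets_at_top)
      fix F F' assume "(finite F \<and> F0 \<subseteq> F) \<and> (finite F' \<and> F0 \<subseteq> F')"
      then show "dist (sum g F) (sum g F') < e"
        using near[of F] near[of F'] dist_triangle2[of "sum g F" "sum g F'" "sum g F0"] \<open>e > 0\<close>
        by linarith
    qed
  qed
  then have "cauchy_filter (filtermap (sum g) (finite_subsets_at_top UNIV))"
    by (simp add: cauchy_filter_metric_filtermap)
  moreover have "complete (UNIV::'a set)"
    by (meson Cauchy_convergent UNIV_I complete_def convergent_def)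
  ultimately obtain L where "(sum g \<longlongrightarrow> L) (finite_subsets_at_top UNIV)"
    using complete_uniform[where S=UNIV] by (force simp add: filterlim_def)
  then show ?thesis
    using summable_on_def has_sum_def by blast
qed

text \<open>Closes the arguments that test a quantity against itself, without assuming that the
  cancelled factor is nonzero.\<close>

lemma le_of_square_le_mult:
  fixes s K :: real
  assumes "s\<^sup>2 \<le> K * s" "0 \<le> K"
  shows "s \<le> K"
  using assms by (cases "s > 0") (auto simp: power2_eq_square)

section \<open>Conjugation, inner product and Cauchy-Schwarz\<close>

lemma scalar_conj_0 [simp]: "scalar_conj (0::'k::hilbert_scalar) = 0"
  using scalar_conj_add[of "0::'k" 0] by simp

lemma norm_scalar_conj [simp]: "norm (scalar_conj z) = norm (z::'k::hilbert_scalar)"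
proof (cases "z = 0")
  case False
  have "norm z * norm (scalar_conj z) = norm (z * scalar_conj z)" by (simp add: norm_mult)
  also have "\<dots> = norm z * norm z" unfolding mult_scalar_conj by (simp add: power2_eq_square)
  finally show ?thesis using False by simp
qed simp

lemma scalar_conj_of_real [simp]: "scalar_conj (of_real r) = (of_real r :: 'k::hilbert_scalar)"
  unfolding of_real_def by (rule scalar_conj_scaleR_one)

lemma mult_scalar_conj_of_real: "z * scalar_conj z = of_real ((norm (z::'k::hilbert_scalar))\<^sup>2)"
  unfolding of_real_def by (rule mult_scalar_conj)

context hilbert_space
begin

text \<open>The axioms tie only real scalars directly to the norm; for the others homogeneity comes
  from \<open>ip_self\<close> and \<open>mult_scalar_conj\<close>.\<close>

lemma norm_smul [simp]: "norm (smul c x) = norm c * norm x"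
proof -
  have "ip (smul c x) (smul c x) = c * scalar_conj (c * ip x x)"
    by (metis ip_commute ip_smul_left)
  also have "\<dots> = (c * scalar_conj c) * scalar_conj (ip x x)"
    by (simp add: scalar_conj_mult)
  also have "\<dots> = of_real ((norm c)\<^sup>2 * (norm x)\<^sup>2)"
    by (simp only: mult_scalar_conj_of_real ip_self scalar_conj_of_real of_real_mult)
  finally have "(norm (smul c x))\<^sup>2 = (norm c * norm x)\<^sup>2"
    by (simp only: ip_self of_real_eq_iff power_mult_distrib)
  then show ?thesis by simp
qed

lemma ip_0_left [simp]: "ip 0 y = 0"
  using ip_add_left[of 0 0 y] by simp

lemma ip_minus_left: "ip (x - y) z = ip x z - ip y z"
  using ip_add_left[of "x - y" y z] by (simp add: algebra_simps)

lemma ip_add_right: "ip x (y + z) = ip x y + ip x z"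
  by (metis ip_add_left ip_commute scalar_conj_add)

lemma ip_0_right [simp]: "ip x 0 = 0"
  using ip_add_right[of x 0 0] by simp

lemma ip_minus_right: "ip x (y - z) = ip x y - ip x z"
  using ip_add_right[of x "y - z" z] by (simp add: algebra_simps)

lemma ip_scaleR_left: "ip (r *\<^sub>R x) y = of_real r * ip x y"
  by (metis ip_smul_left smul_of_real)

lemma ip_smul_right: "ip x (smul c y) = scalar_conj c * ip x y"
  by (metis ip_smul_left ip_commute scalar_conj_mult)

lemma ip_scaleR_right: "ip x (r *\<^sub>R y) = of_real r * ip x y"
  by (metis ip_smul_right smul_of_real scalar_conj_of_real)

lemma ip_sum_left: "ip (sum f F) y = (\<Sum>i\<in>F. ip (f i) y)"
  by (induction F rule: infinite_finite_induct) (auto simp: ip_add_left)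

lemma norm_ip_commute: "norm (ip x y) = norm (ip y x)"
  by (metis ip_commute norm_scalar_conj)

lemma ip_mult_commute: "ip x y * ip y x = of_real ((norm (ip x y))\<^sup>2)"
  by (metis ip_commute mult_scalar_conj_of_real)

lemma norm_ip_self: "norm (ip x x) = (norm x)\<^sup>2"
  unfolding ip_self by (simp del: of_real_power)

lemma norm_ip_le: "norm (ip x y) \<le> norm x * norm y"
proof (cases "y = 0")
  case False
  \<comment> \<open>The component of \<open>x\<close> orthogonal to \<open>y\<close>, multiplied by
    the square of \<open>norm y\<close> to avoid a division.\<close>
  define z where "z = (norm y)\<^sup>2 *\<^sub>R x - smul (ip x y) y"
  have "ip z y = 0"
    by (simp add: z_def ip_minus_left ip_scaleR_left ip_smul_left ip_self)
  then have "ip z z = of_real ((norm y)\<^sup>2) * ip z x"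
    by (simp add: z_def ip_minus_right ip_scaleR_right ip_smul_right)
  also have "ip z x = of_real ((norm y)\<^sup>2 * (norm x)\<^sup>2 - (norm (ip x y))\<^sup>2)"
    unfolding z_def ip_minus_left ip_scaleR_left ip_smul_left ip_mult_commute
    by (simp add: ip_self)
  finally have "(norm z)\<^sup>2 = (norm y)\<^sup>2 * ((norm y)\<^sup>2 * (norm x)\<^sup>2 - (norm (ip x y))\<^sup>2)"
    by (simp only: ip_self of_real_mult[symmetric] of_real_eq_iff)
  then have "0 \<le> (norm y)\<^sup>2 * ((norm y)\<^sup>2 * (norm x)\<^sup>2 - (norm (ip x y))\<^sup>2)"
    by (metis zero_le_power2)
  then have "(norm (ip x y))\<^sup>2 \<le> (norm x * norm y)\<^sup>2"
    using False by (simp add: zero_le_mult_iff power_mult_distrib mult.commute)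
  then show ?thesis by (rule power2_le_imp_le) simp
qed simp

lemma bounded_linear_ip_left: "bounded_linear (\<lambda>x. ip x y)"
  by (rule bounded_linear_intro[where K="norm y"])
    (auto simp: ip_add_left ip_scaleR_left norm_ip_le scaleR_conv_of_real)

lemma bounded_linear_ip_right: "bounded_linear (\<lambda>y. ip x y)"
  by (rule bounded_linear_intro[where K="norm x"])
    (use norm_ip_le[of x] in \<open>auto simp: ip_add_right ip_scaleR_right scaleR_conv_of_real mult.commute\<close>)

lemma ip_eqI: "(\<And>z. ip z x = ip z y) \<Longrightarrow> x = y"
proof -
  assume *: "\<And>z. ip z x = ip z y"
  have "ip (x - y) (x - y) = 0" by (simp add: * ip_minus_right)
  then show "x = y" by (simp add: ip_self)
qed

section \<open>Bounded linear operators\<close>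

lemma bounded_operatorI:
  assumes "\<And>x y. V (x + y) = V x + V y" "\<And>c x. V (smul c x) = smul c (V x)"
    and "\<And>x. norm (V x) \<le> K * norm x"
  shows "bounded_operator smul V"
  unfolding bounded_operator_def
proof
  show "Vector_Spaces.linear smul smul V"
    unfolding Vector_Spaces.linear_iff using assms vector_space_axioms by blast
  show "bounded_linear V"
  proof (rule bounded_linear_intro[where K=K])
    show "V (r *\<^sub>R x) = r *\<^sub>R V x" for r x
      using assms(2)[of "of_real r" x] by (simp add: smul_of_real)
  qed (use assms in \<open>auto simp: mult.commute\<close>)
qed

lemma bounded_operatorD:
  assumes "bounded_operator smul V"
  shows "V (x + y) = V x + V y" "V (smul c x) = smul c (V x)" "bounded_linear V"
    "V (\<Sum>i\<in>F. smul (b i) (\<phi> i)) = (\<Sum>i\<in>F. smul (b i) (V (\<phi> i)))"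
proof -
  have lin: "Vector_Spaces.linear smul smul V" using assms by (simp add: bounded_operator_def)
  then show "V (x + y) = V x + V y" and smul: "V (smul c x) = smul c (V x)" for c x
    unfolding Vector_Spaces.linear_iff by auto
  show bl: "bounded_linear V" using assms by (simp add: bounded_operator_def)
  then show "V (\<Sum>i\<in>F. smul (b i) (\<phi> i)) = (\<Sum>i\<in>F. smul (b i) (V (\<phi> i)))"
    by (simp add: linear_sum[OF bounded_linear.linear] smul)
qed

lemma bounded_operator_compose:
  assumes "bounded_operator smul V" "bounded_operator smul W"
  shows "bounded_operator smul (\<lambda>x. V (W x))"
proof (rule bounded_operatorI)
  have "bounded_linear (\<lambda>x. V (W x))"
    using assms by (intro bounded_linear_compose[of V W]) (auto simp: bounded_operator_def)
  then show "norm (V (W x)) \<le> onorm (\<lambda>x. V (W x)) * norm x" for x by (rule onorm)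
qed (use assms in \<open>simp_all add: bounded_operatorD\<close>)

lemma bounded_operator_diff_id:
  assumes "bounded_operator smul V"
  shows "bounded_operator smul (\<lambda>x. x - V x)"
proof (rule bounded_operatorI)
  have "bounded_linear (\<lambda>x. x - V x)"
    using assms by (intro bounded_linear_sub bounded_linear_ident) (simp add: bounded_operator_def)
  then show "norm (x - V x) \<le> onorm (\<lambda>x. x - V x) * norm x" for x by (rule onorm)
qed (use assms in \<open>simp_all add: bounded_operatorD scale_right_diff_distrib\<close>)

lemma bounded_operator_scaleR:
  assumes "bounded_operator smul V"
  shows "bounded_operator smul (\<lambda>x. c *\<^sub>R V x)"
proof -
  have "bounded_operator smul (\<lambda>x. c *\<^sub>R x)"
    by (rule bounded_operatorI[where K="\<bar>c\<bar>"])
      (simp_all add: scale_right_distrib scale_left_commute flip: smul_of_real)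
  then show ?thesis using assms by (rule bounded_operator_compose)
qed

section \<open>Bessel families and estimates on finite sums\<close>

text \<open>Finite sums make summability a consequence and allow test vectors that are finite
  combinations. The sign of \<open>B\<close> is stated because the inequality does not force it in
  the zero space.\<close>

definition bessel_bound :: "real \<Rightarrow> ('i \<Rightarrow> 'a) \<Rightarrow> bool" where
  "bessel_bound B \<phi> \<longleftrightarrow> 0 \<le> B \<and>
     (\<forall>f F. finite F \<longrightarrow> (\<Sum>i\<in>F. (norm (ip f (\<phi> i)))\<^sup>2) \<le> B * (norm f)\<^sup>2)"

lemma bessel_boundD:
  assumes "bessel_bound B \<phi>"
  shows "0 \<le> B"
    and "finite F \<Longrightarrow> (\<Sum>i\<in>F. (norm (ip f (\<phi> i)))\<^sup>2) \<le> B * (norm f)\<^sup>2"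
    and "(\<lambda>i. (norm (ip f (\<phi> i)))\<^sup>2) summable_on UNIV"
    and "(\<Sum>\<^sub>\<infinity>i. (norm (ip f (\<phi> i)))\<^sup>2) \<le> B * (norm f)\<^sup>2"
proof -
  show "0 \<le> B" using assms by (simp add: bessel_bound_def)
  show fin: "(\<Sum>i\<in>F. (norm (ip f (\<phi> i)))\<^sup>2) \<le> B * (norm f)\<^sup>2" if "finite F" for F
    using assms that by (simp add: bessel_bound_def)
  show "(\<lambda>i. (norm (ip f (\<phi> i)))\<^sup>2) summable_on UNIV"
    by (rule nonneg_bdd_above_summable_on) (auto simp: bdd_above_def intro!: fin)
  then show "(\<Sum>\<^sub>\<infinity>i. (norm (ip f (\<phi> i)))\<^sup>2) \<le> B * (norm f)\<^sup>2"
    by (rule infsum_le_finite_sums) (rule fin)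
qed

lemma bessel_bound_imp_bessel_sequence: "bessel_bound B \<phi> \<Longrightarrow> bessel_sequence ip \<phi>"
  unfolding bessel_sequence_def using bessel_boundD by blast

lemma frame_imp_bessel_bound:
  fixes \<phi> :: "'i \<Rightarrow> 'a"
  assumes "frame_with_bounds ip A B \<phi>"
  shows "bessel_bound B \<phi>"
  unfolding bessel_bound_def
proof (intro conjI allI impI)
  show "0 \<le> B" using assms by (simp add: frame_with_bounds_def)
  fix f and F :: "'i set" assume "finite F"
  then have "(\<Sum>i\<in>F. (norm (ip f (\<phi> i)))\<^sup>2) \<le> (\<Sum>\<^sub>\<infinity>i. (norm (ip f (\<phi> i)))\<^sup>2)"
    using assms by (intro finite_sum_le_infsum) (auto simp: frame_with_bounds_def)
  also have "\<dots> \<le> B * (norm f)\<^sup>2" using assms by (simp add: frame_with_bounds_def)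
  finally show "(\<Sum>i\<in>F. (norm (ip f (\<phi> i)))\<^sup>2) \<le> B * (norm f)\<^sup>2" .
qed

text \<open>For g the finite combination, ||g||^2 is the sum of c_i <phi_i, g>. Cauchy-Schwarz over
  \<open>F\<close> and the Bessel bound at g itself bound ||g||^4 by a multiple of ||g||^2.\<close>

lemma norm_finite_synthesis_le:
  assumes "bessel_bound B \<phi>" "finite F"
  shows "(norm (\<Sum>i\<in>F. smul (c i) (\<phi> i)))\<^sup>2 \<le> B * (\<Sum>i\<in>F. (norm (c i))\<^sup>2)"
proof -
  define g where "g = (\<Sum>i\<in>F. smul (c i) (\<phi> i))"
  have "ip g g = (\<Sum>i\<in>F. c i * ip (\<phi> i) g)"
    by (subst (1) g_def) (simp add: ip_sum_left ip_smul_left)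
  then have "(norm g)\<^sup>2 = norm (\<Sum>i\<in>F. c i * ip (\<phi> i) g)"
    by (metis norm_ip_self)
  also have "\<dots> \<le> (\<Sum>i\<in>F. norm (c i) * norm (ip g (\<phi> i)))"
    by (rule order.trans[OF norm_sum]) (simp add: norm_mult norm_ip_commute[of g])
  finally have "((norm g)\<^sup>2)\<^sup>2 \<le> (\<Sum>i\<in>F. norm (c i) * norm (ip g (\<phi> i)))\<^sup>2"
    by (rule power_mono) simp
  also have "\<dots> \<le> (\<Sum>i\<in>F. (norm (c i))\<^sup>2) * (\<Sum>i\<in>F. (norm (ip g (\<phi> i)))\<^sup>2)"
    by (rule Cauchy_Schwarz_ineq_sum)
  also have "\<dots> \<le> (\<Sum>i\<in>F. (norm (c i))\<^sup>2) * (B * (norm g)\<^sup>2)"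
    by (intro mult_left_mono bessel_boundD(2)[OF assms] sum_nonneg) simp
  finally have "((norm g)\<^sup>2)\<^sup>2 \<le> (B * (\<Sum>i\<in>F. (norm (c i))\<^sup>2)) * (norm g)\<^sup>2"
    by (simp add: mult_ac)
  then show ?thesis
    unfolding g_def[symmetric]
    by (rule le_of_square_le_mult) (simp add: bessel_boundD(1)[OF assms(1)] sum_nonneg)
qed

text \<open>Testing \<open>V\<close> on the finite sums \<open>\<Sum> \<langle>y, V \<phi>\<^sub>i\<rangle> \<phi>\<^sub>i\<close> avoids any appeal to the adjoint of \<open>V\<close>.\<close>

lemma bessel_bound_image:
  fixes \<phi> :: "'i \<Rightarrow> 'a"
  assumes "bessel_bound B \<phi>" "bounded_operator smul V"
    and le: "\<And>x. norm (V x) \<le> K * norm x"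
  shows "bessel_bound (K\<^sup>2 * B) (\<lambda>i. V (\<phi> i))"
  unfolding bessel_bound_def
proof (intro conjI allI impI)
  show "0 \<le> K\<^sup>2 * B" using bessel_boundD(1)[OF assms(1)] by simp
  fix y and F :: "'i set" assume "finite F"
  define s where "s = (\<Sum>i\<in>F. (norm (ip y (V (\<phi> i))))\<^sup>2)"
  define g where "g = (\<Sum>i\<in>F. smul (ip y (V (\<phi> i))) (\<phi> i))"
  have "0 \<le> s" by (simp add: s_def sum_nonneg)
  have "ip (V g) y = of_real s"
    unfolding g_def s_def bounded_operatorD(4)[OF assms(2)]
    by (simp add: ip_sum_left ip_smul_left ip_mult_commute)
  then have "s \<le> norm (V g) * norm y"
    using norm_ip_le[of "V g" y] \<open>0 \<le> s\<close> by simp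
  also have "\<dots> \<le> K * norm g * norm y" by (intro mult_right_mono le) simp
  finally have "s\<^sup>2 \<le> (K * norm g * norm y)\<^sup>2" using \<open>0 \<le> s\<close> by (rule power_mono)
  also have "\<dots> = K\<^sup>2 * (norm y)\<^sup>2 * (norm g)\<^sup>2" by (simp add: power_mult_distrib)
  also have "\<dots> \<le> K\<^sup>2 * (norm y)\<^sup>2 * (B * s)"
    unfolding g_def s_def by (intro mult_left_mono norm_finite_synthesis_le assms \<open>finite F\<close>) simp
  finally have "s\<^sup>2 \<le> (K\<^sup>2 * B * (norm y)\<^sup>2) * s" by (simp add: mult_ac)
  then show "s \<le> K\<^sup>2 * B * (norm y)\<^sup>2"
    by (rule le_of_square_le_mult) (simp add: bessel_boundD(1)[OF assms(1)])
qed

section \<open>Synthesis and cross frame operators\<close>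

text \<open>Excludes the default value 0 of \<open>infsum\<close>: the series behind
  \<open>synthesis\<close> really converges.\<close>

lemma synthesis_has_sum:
  assumes "bessel_bound B \<phi>" "(\<lambda>i. (norm (c i))\<^sup>2) summable_on UNIV"
  shows "((\<lambda>i. smul (c i) (\<phi> i)) has_sum synthesis smul \<phi> c) UNIV"
  unfolding synthesis_def
  by (intro has_sum_infsum summable_on_of_norm_sum_bound[OF assms(2)])
    (auto intro: norm_finite_synthesis_le[OF assms(1)])

lemma norm_synthesis_le:
  assumes "bessel_bound B \<phi>" "(\<lambda>i. (norm (c i))\<^sup>2) summable_on UNIV"
  shows "(norm (synthesis smul \<phi> c))\<^sup>2 \<le> B * (\<Sum>\<^sub>\<infinity>i. (norm (c i))\<^sup>2)"
proof (rule tendsto_upperbound)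
  show "((\<lambda>F. (norm (\<Sum>i\<in>F. smul (c i) (\<phi> i)))\<^sup>2) \<longlongrightarrow> (norm (synthesis smul \<phi> c))\<^sup>2)
      (finite_subsets_at_top UNIV)"
    using synthesis_has_sum[OF assms] unfolding has_sum_def by (intro tendsto_intros)
  have "(norm (\<Sum>i\<in>F. smul (c i) (\<phi> i)))\<^sup>2 \<le> B * (\<Sum>\<^sub>\<infinity>i. (norm (c i))\<^sup>2)" if "finite F" for F
  proof -
    have "(\<Sum>i\<in>F. (norm (c i))\<^sup>2) \<le> (\<Sum>\<^sub>\<infinity>i. (norm (c i))\<^sup>2)"
      using that by (intro finite_sum_le_infsum assms) auto
    then show ?thesis
      using norm_finite_synthesis_le[OF assms(1) that, of c] bessel_boundD(1)[OF assms(1)]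
      by (meson mult_left_mono order_trans)
  qed
  then show "\<forall>\<^sub>F F in finite_subsets_at_top UNIV.
      (norm (\<Sum>i\<in>F. smul (c i) (\<phi> i)))\<^sup>2 \<le> B * (\<Sum>\<^sub>\<infinity>i. (norm (c i))\<^sup>2)"
    by (simp add: eventually_finite_subsets_at_top_weakI)
qed simp

text \<open>Moves V out of the synthesis of the image family; this turns the operator of the pair
  into V S, and it also expands T x in the construction of T*.\<close>

lemma synthesis_image:
  assumes "bessel_bound B \<phi>" "(\<lambda>i. (norm (c i))\<^sup>2) summable_on UNIV" "bounded_operator smul V"
  shows "synthesis smul (\<lambda>i. V (\<phi> i)) c = V (synthesis smul \<phi> c)"
  using has_sum_bounded_linear[OF bounded_operatorD(3)[OF assms(3)] synthesis_has_sum[OF assms(1,2)]]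
  by (simp add: synthesis_def bounded_operatorD(2)[OF assms(3)] infsumI)

text \<open>This is T_phi T_theta*. Equal families give the frame operator, and the approximate dual
  condition compares such an operator with the identity.\<close>

abbreviation mixed_frame_operator :: "('i \<Rightarrow> 'a) \<Rightarrow> ('i \<Rightarrow> 'a) \<Rightarrow> 'a \<Rightarrow> 'a" where
  "mixed_frame_operator \<phi> \<theta> f \<equiv> synthesis smul \<phi> (analysis ip \<theta> f)"

lemma mixed_frame_operator_has_sum:
  assumes "bessel_bound B \<phi>" "bessel_bound C \<theta>"
  shows "((\<lambda>i. smul (ip f (\<theta> i)) (\<phi> i)) has_sum mixed_frame_operator \<phi> \<theta> f) UNIV"
  using synthesis_has_sum[OF assms(1), of "analysis ip \<theta> f"] bessel_boundD(3)[OF assms(2)]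
  by (simp add: analysis_def)

lemma ip_mixed_frame_operator_has_sum:
  assumes "bessel_bound B \<phi>" "bessel_bound C \<theta>"
  shows "((\<lambda>i. ip f (\<theta> i) * ip (\<phi> i) g) has_sum ip (mixed_frame_operator \<phi> \<theta> f) g) UNIV"
  using has_sum_bounded_linear[OF bounded_linear_ip_left mixed_frame_operator_has_sum[OF assms]]
  by (simp add: ip_smul_left)

text \<open>Both sides are sums of one scalar series, with terms <f, theta_i> <phi_i, g>.\<close>

lemma mixed_frame_operator_adjoint:
  assumes "bessel_bound B \<phi>" "bessel_bound C \<theta>"
  shows "ip (mixed_frame_operator \<phi> \<theta> f) g = ip f (mixed_frame_operator \<theta> \<phi> g)"
proof -
  have "((\<lambda>i. ip f (\<theta> i) * ip (\<phi> i) g) has_sum ip f (mixed_frame_operator \<theta> \<phi> g)) UNIV"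
    using has_sum_bounded_linear[OF bounded_linear_ip_right mixed_frame_operator_has_sum[OF assms(2,1)]]
    by (simp add: ip_smul_right mult.commute flip: ip_commute)
  with ip_mixed_frame_operator_has_sum[OF assms] show ?thesis by (rule has_sum_unique)
qed

lemma bounded_operator_mixed_frame_operator:
  assumes "bessel_bound B \<phi>" "bessel_bound C \<theta>"
  shows "bounded_operator smul (mixed_frame_operator \<phi> \<theta>)"
proof (rule bounded_operatorI)
  note sum = mixed_frame_operator_has_sum[OF assms]
  show "mixed_frame_operator \<phi> \<theta> (x + y) = mixed_frame_operator \<phi> \<theta> x + mixed_frame_operator \<phi> \<theta> y"
    for x y
    by (rule has_sum_unique[OF sum])
      (use has_sum_add[OF sum sum, of x y] in \<open>simp add: ip_add_left scale_left_distrib\<close>)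
  \<comment> \<open>Instead of pulling the scalar out of the series, the adjoint identity moves the
    operator to the second slot, where the scalar no longer meets it.\<close>
  show "mixed_frame_operator \<phi> \<theta> (smul c x) = smul c (mixed_frame_operator \<phi> \<theta> x)" for c x
  proof (rule ip_eqI)
    fix z
    have "ip (mixed_frame_operator \<phi> \<theta> (smul c x)) z = ip (smul c (mixed_frame_operator \<phi> \<theta> x)) z"
      by (simp add: mixed_frame_operator_adjoint[OF assms] ip_smul_left)
    then show "ip z (mixed_frame_operator \<phi> \<theta> (smul c x)) = ip z (smul c (mixed_frame_operator \<phi> \<theta> x))"
      by (metis ip_commute)
  qed
  \<comment> \<open>Synthesis contributes the factor \<open>sqrt B\<close>, analysis the factor
    \<open>sqrt C\<close>.\<close>
  show "norm (mixed_frame_operator \<phi> \<theta> x) \<le> sqrt (B * C) * norm x" for x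
  proof (rule power2_le_imp_le)
    have "(norm (mixed_frame_operator \<phi> \<theta> x))\<^sup>2 \<le> B * (\<Sum>\<^sub>\<infinity>i. (norm (ip x (\<theta> i)))\<^sup>2)"
      using norm_synthesis_le[OF assms(1), of "analysis ip \<theta> x"] bessel_boundD(3)[OF assms(2)]
      by (simp add: analysis_def)
    also have "\<dots> \<le> B * (C * (norm x)\<^sup>2)"
      by (intro mult_left_mono bessel_boundD(4)[OF assms(2)] bessel_boundD(1)[OF assms(1)])
    finally show "(norm (mixed_frame_operator \<phi> \<theta> x))\<^sup>2 \<le> (sqrt (B * C) * norm x)\<^sup>2"
      using bessel_boundD(1)[OF assms(1)] bessel_boundD(1)[OF assms(2)]
      by (simp add: power_mult_distrib)
  qed (use assms[THEN bessel_boundD(1)] in simp)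
qed

lemma ip_frame_operator:
  assumes "bessel_bound B \<phi>"
  shows "ip (frame_operator smul ip \<phi> f) f = of_real (\<Sum>\<^sub>\<infinity>i. (norm (ip f (\<phi> i)))\<^sup>2)"
proof (rule has_sum_unique)
  show "((\<lambda>i. ip f (\<phi> i) * ip (\<phi> i) f) has_sum ip (frame_operator smul ip \<phi> f) f) UNIV"
    unfolding frame_operator_def by (rule ip_mixed_frame_operator_has_sum[OF assms assms])
  show "((\<lambda>i. ip f (\<phi> i) * ip (\<phi> i) f) has_sum of_real (\<Sum>\<^sub>\<infinity>i. (norm (ip f (\<phi> i)))\<^sup>2)) UNIV"
    unfolding ip_mult_commute
    by (intro has_sum_of_real has_sum_infsum bessel_boundD(3)[OF assms])
qed

section \<open>The frame operator, its inverse, adjoints, and perturbation of frames\<close>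

context
  fixes A B :: real and \<phi> :: "'i \<Rightarrow> 'a"
  assumes frame: "frame_with_bounds ip A B \<phi>"
begin

abbreviation (input) "S \<equiv> frame_operator smul ip \<phi>"

lemma bounded_operator_frame_operator: "bounded_operator smul S"
  using bounded_operator_mixed_frame_operator[OF frame_imp_bessel_bound[OF frame] frame_imp_bessel_bound[OF frame]]
  by (simp add: frame_operator_def[abs_def])

lemma frame_operator_selfadjoint: "ip (S f) g = ip f (S g)"
  using mixed_frame_operator_adjoint[OF frame_imp_bessel_bound[OF frame] frame_imp_bessel_bound[OF frame]]
  by (simp add: frame_operator_def)

text \<open>Serves twice: for injectivity of \<open>S\<close> and for the bound \<open>1 / A\<close>
  on its inverse.\<close>

lemma norm_frame_operator_ge: "A * norm f \<le> norm (S f)"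
proof (cases "f = 0")
  case False
  have "A * (norm f)\<^sup>2 \<le> (\<Sum>\<^sub>\<infinity>i. (norm (ip f (\<phi> i)))\<^sup>2)"
    using frame by (simp add: frame_with_bounds_def)
  also have "\<dots> \<le> norm (ip (S f) f)"
    by (simp add: ip_frame_operator[OF frame_imp_bessel_bound[OF frame]])
  also have "\<dots> \<le> norm (S f) * norm f" by (rule norm_ip_le)
  finally show ?thesis using False by (simp add: power2_eq_square)
qed simp

text \<open>Since \<open>\<parallel>S f\<parallel>\<^sup>2 \<le> B \<langle>S f, f\<rangle>\<close> and \<open>\<langle>S f, f\<rangle> \<ge> A \<parallel>f\<parallel>\<^sup>2\<close>, expanding the square gives a contraction.\<close>

lemma norm_diff_frame_operator_le:
  "norm (f - (1 / B) *\<^sub>R S f) \<le> sqrt (1 - A / B) * norm f"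
proof (rule power2_le_imp_le)
  have AB: "0 < A" "A \<le> B" using frame by (auto simp: frame_with_bounds_def)
  define s where "s = (\<Sum>\<^sub>\<infinity>i. (norm (ip f (\<phi> i)))\<^sup>2)"
  define t where "t = 1 / B"
  note bessel = frame_imp_bessel_bound[OF frame]
  have Sff: "ip (S f) f = of_real s"
    unfolding s_def by (rule ip_frame_operator[OF bessel])
  then have fSf: "ip f (S f) = of_real s" by (simp add: frame_operator_selfadjoint)
  have "ip (f - t *\<^sub>R S f) (f - t *\<^sub>R S f) = of_real ((norm f)\<^sup>2 - 2 * t * s + t\<^sup>2 * (norm (S f))\<^sup>2)"
    unfolding ip_minus_left ip_minus_right ip_scaleR_left ip_scaleR_right Sff fSf
    by (simp add: ip_self algebra_simps power2_eq_square)
  then have "(norm (f - t *\<^sub>R S f))\<^sup>2 = (norm f)\<^sup>2 - 2 * t * s + t\<^sup>2 * (norm (S f))\<^sup>2"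
    unfolding ip_self of_real_eq_iff .
  also have "\<dots> \<le> (norm f)\<^sup>2 - 2 * t * s + t\<^sup>2 * (B * s)"
    using norm_synthesis_le[OF bessel, of "analysis ip \<phi> f"] bessel_boundD(3)[OF bessel]
    by (simp add: s_def analysis_def frame_operator_def mult_left_mono)
  \<comment> \<open>For \<open>t = 1 / B\<close> the quadratic term is \<open>t * s\<close>, which
    takes back exactly half of the linear one.\<close>
  also have "\<dots> = (norm f)\<^sup>2 - t * s"
    using AB by (simp add: t_def power2_eq_square field_simps)
  also have "\<dots> \<le> (norm f)\<^sup>2 - t * (A * (norm f)\<^sup>2)"
    using frame AB by (simp add: frame_with_bounds_def s_def t_def divide_right_mono)
  also have "\<dots> = (sqrt (1 - A / B) * norm f)\<^sup>2"
    using AB by (simp add: t_def power_mult_distrib algebra_simps)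
  finally show "(norm (f - (1 / B) *\<^sub>R S f))\<^sup>2 \<le> (sqrt (1 - A / B) * norm f)\<^sup>2"
    by (simp add: t_def)
qed (use frame in \<open>simp add: frame_with_bounds_def\<close>)

lemma bij_frame_operator: "bij S"
proof (rule bijI)
  have AB: "0 < A" "A \<le> B" using frame by (auto simp: frame_with_bounds_def)
  interpret S: bounded_linear S by (rule bounded_operatorD(3)[OF bounded_operator_frame_operator])
  show "inj S"
  proof (rule injI)
    fix x y assume "S x = S y"
    then have "A * norm (x - y) \<le> 0" using norm_frame_operator_ge[of "x - y"] by (simp add: S.diff)
    then show "x = y" using AB by (simp add: mult_le_0_iff)
  qed
  show "surj S"
  proof (rule surjI)
    fix y
    \<comment> \<open>The fixed points of \<open>?G\<close> are the solutions of
      \<open>S x = y\<close>, and on differences \<open>?G\<close> acts as the contraction I -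
      S/B.\<close>
    let ?G = "\<lambda>x. x + (1 / B) *\<^sub>R (y - S x)"
    have "dist (?G x) (?G x') \<le> sqrt (1 - A / B) * dist x x'" for x x'
    proof -
      have "?G x - ?G x' = (x - x') - (1 / B) *\<^sub>R S (x - x')"
        by (simp add: S.diff algebra_simps)
      then show ?thesis unfolding dist_norm by (simp only: norm_diff_frame_operator_le)
    qed
    then have "\<exists>!x. ?G x = x"
      using AB by (intro banach_fix_type[of "sqrt (1 - A / B)"]) auto
    then have "\<exists>x. S x = y" using AB by auto
    then show "S (SOME x. S x = y) = y" by (rule someI_ex)
  qed
qed

lemma frame_operator_inv [simp]: "S (inv S f) = f" "inv S (S f) = f"
  using bij_frame_operator by (simp_all add: bij_is_surj surj_f_inv_f bij_is_inj)

lemma bounded_operator_inv_frame_operator: "bounded_operator smul (inv S)"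
proof (rule bounded_operatorI)
  note inj = injD[OF bij_is_inj[OF bij_frame_operator]]
  note S = bounded_operatorD[OF bounded_operator_frame_operator]
  show "inv S (x + y) = inv S x + inv S y" for x y by (rule inj) (simp add: S)
  show "inv S (smul c x) = smul c (inv S x)" for c x by (rule inj) (simp add: S)
  show "norm (inv S x) \<le> (1 / A) * norm x" for x
    using norm_frame_operator_ge[of "inv S x"] frame by (simp add: frame_with_bounds_def field_simps)
qed

text \<open>The frame replaces the Riesz representation theorem: expanding \<open>x = S (S\<^sup>-\<^sup>1 x)\<close> in the frame
  shows that \<open>T\<^sup>* = S\<^sup>-\<^sup>1 U\<close>, where \<open>U y = \<Sum> \<langle>y, T \<phi>\<^sub>i\<rangle> \<phi>\<^sub>i\<close>.\<close>

lemma hilbert_adjoint: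
  assumes T: "bounded_operator smul T"
  shows "bounded_operator smul (hilbert_adjoint ip T)" (is ?op)
    and "ip (T x) y = ip x (hilbert_adjoint ip T y)" (is ?adj)
proof -
  note bessel = frame_imp_bessel_bound[OF frame]
  have T_le: "norm (T x) \<le> onorm T * norm x" for x
    using bounded_operatorD(3)[OF T] by (rule onorm)
  define \<theta> where "\<theta> = (\<lambda>i. T (\<phi> i))"
  have bessel\<theta>: "bessel_bound ((onorm T)\<^sup>2 * B) \<theta>"
    unfolding \<theta>_def by (rule bessel_bound_image[OF bessel T T_le])
  define T' where "T' = (\<lambda>y. inv S (mixed_frame_operator \<phi> \<theta> y))"
  have adj: "ip (T x) y = ip x (T' y)" for x y
  proof -
    have "T x = T (mixed_frame_operator \<phi> \<phi> (inv S x))"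
      by (simp flip: frame_operator_def)
    also have "\<dots> = mixed_frame_operator \<theta> \<phi> (inv S x)"
      unfolding \<theta>_def
      by (rule synthesis_image[OF bessel _ T, symmetric])
        (simp add: analysis_def bessel_boundD(3)[OF bessel])
    \<comment> \<open>\<open>S\<close> appears in front of \<open>T' y\<close> so that
      self-adjointness can move it onto \<open>inv S x\<close>, where it cancels.\<close>
    finally have "ip (T x) y = ip (inv S x) (S (T' y))"
      by (simp add: mixed_frame_operator_adjoint[OF bessel\<theta> bessel] T'_def)
    then show ?thesis by (simp flip: frame_operator_selfadjoint)
  qed
  have "hilbert_adjoint ip T = T'"
    unfolding hilbert_adjoint_def
  \<comment> \<open>The definite description needs uniqueness: inner products determine a
    vector.\<close>
  proof (rule the_equality)
    show "V = T'" if "\<forall>x y. ip (T x) y = ip x (V y)" for V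
      using that adj by (intro ext ip_eqI) metis
  qed (simp add: adj)
  moreover have "bounded_operator smul T'"
    unfolding T'_def
    by (rule bounded_operator_compose[OF bounded_operator_inv_frame_operator
          bounded_operator_mixed_frame_operator[OF bessel bessel\<theta>]])
  ultimately show ?op ?adj using adj by simp_all
qed

lemma norm_diff_hilbert_adjoint_le:
  assumes T: "bounded_operator smul T"
  shows "norm (y - hilbert_adjoint ip T y) \<le> onorm (\<lambda>x. x - T x) * norm y"
proof -
  define z where "z = y - hilbert_adjoint ip T y"
  have "ip (z - T z) y = ip z z"
    by (simp add: z_def[symmetric] ip_minus_left hilbert_adjoint(2)[OF T] flip: ip_minus_right)
  then have "(norm z)\<^sup>2 \<le> norm (z - T z) * norm y"
    by (metis norm_ip_le norm_ip_self)
  also have "norm (z - T z) \<le> onorm (\<lambda>x. x - T x) * norm z"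
    using bounded_operatorD(3)[OF bounded_operator_diff_id[OF T]] by (rule onorm)
  finally have "(norm z)\<^sup>2 \<le> onorm (\<lambda>x. x - T x) * norm y * norm z"
    by (simp add: mult_right_mono mult_ac)
  then show ?thesis
    unfolding z_def[symmetric]
    by (rule le_of_square_le_mult)
      (simp add: onorm_pos_le bounded_operatorD(3)[OF bounded_operator_diff_id[OF T]])
qed

text \<open>The lower bound comes from \<open>\<bar>a\<bar>\<^sup>2 \<le> (1 + t) \<bar>a - d\<bar>\<^sup>2 + (1 + 1/t) \<bar>d\<bar>\<^sup>2\<close> with \<open>t\<close> so large that
  \<open>(1 + 1/t) D < A\<close>.\<close>

lemma woven_of_small_perturbation:
  assumes diff: "bessel_bound D (\<lambda>i. \<phi> i - \<psi> i)" and "D < A"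
  shows "woven ip \<phi> \<psi>"
proof -
  have AB: "0 < A" "A \<le> B" using frame by (auto simp: frame_with_bounds_def)
  have "0 \<le> D" by (rule bessel_boundD(1)[OF diff])
  \<comment> \<open>The requirement is \<open>D < t * (A - D)\<close>, and this choice gives
    \<open>t * (A - D) = D + A\<close>; the summand 1 keeps \<open>t\<close> positive when
    \<open>D = 0\<close>.\<close>
  define t where "t = 2 * D / (A - D) + 1"
  have "t \<ge> 1" using \<open>0 \<le> D\<close> \<open>D < A\<close> by (simp add: t_def)
  have "D < t * (A - D)" using \<open>D < A\<close> \<open>0 \<le> D\<close> by (simp add: t_def field_simps)
  then have tD: "(1 + 1 / t) * D < A" using \<open>t \<ge> 1\<close> by (simp add: field_simps)
  \<comment> \<open>Obtained by solving the summed estimate for the frame sum of the mixed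
    family.\<close>
  define A' where "A' = (A - (1 + 1 / t) * D) / (1 + t)"
  have "A' > 0" using tD \<open>t \<ge> 1\<close> by (simp add: A'_def)
  \<comment> \<open>Leads to \<open>A' \<le> A\<close>, hence to a lower bound not above the upper
    one, as \<open>frame_with_bounds\<close> demands.\<close>
  have "0 \<le> (1 + 1 / t) * D" using \<open>t \<ge> 1\<close> \<open>0 \<le> D\<close> by simp
  moreover have "A * 1 \<le> A * (1 + t)" using \<open>t \<ge> 1\<close> AB by (intro mult_left_mono) auto
  ultimately have "A - (1 + 1 / t) * D \<le> A * (1 + t)" by linarith
  then have "A' \<le> A" using \<open>t \<ge> 1\<close> by (simp add: A'_def divide_le_eq)
  have young: "(x + y)\<^sup>2 \<le> (1 + t) * x\<^sup>2 + (1 + 1 / t) * y\<^sup>2" for x y :: real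
  proof -
    have "0 \<le> (t * x - y)\<^sup>2 / t" using \<open>t \<ge> 1\<close> by simp
    also have "\<dots> = (1 + t) * x\<^sup>2 + (1 + 1 / t) * y\<^sup>2 - (x + y)\<^sup>2"
      using \<open>t \<ge> 1\<close> by (simp add: field_simps power2_eq_square)
    finally show ?thesis by simp
  qed
  \<comment> \<open>Each mixed vector differs from \<open>\<phi> i\<close> by 0 or by
    \<open>\<phi> i - \<psi> i\<close>, so neither bound depends on \<open>J\<close>. The upper one
    comes from (x + y)^2 <= 2 x^2 + 2 y^2.\<close>
  have "frame_with_bounds ip A' (2 * B + 2 * D) (\<lambda>i. if i \<in> J then \<phi> i else \<psi> i)" for J
  proof -
    define m where "m = (\<lambda>i. if i \<in> J then \<phi> i else \<psi> i)"
    have le_m: "(norm (ip f (\<phi> i)))\<^sup>2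
        \<le> (1 + t) * (norm (ip f (m i)))\<^sup>2 + (1 + 1 / t) * (norm (ip f (\<phi> i - \<psi> i)))\<^sup>2" for f i
    proof -
      have "norm (ip f (\<phi> i)) \<le> norm (ip f (m i)) + norm (ip f (\<phi> i - \<psi> i))"
        using norm_triangle_ineq[of "ip f (\<psi> i)" "ip f (\<phi> i - \<psi> i)"]
        by (simp add: m_def ip_minus_right)
      then have "(norm (ip f (\<phi> i)))\<^sup>2 \<le> (norm (ip f (m i)) + norm (ip f (\<phi> i - \<psi> i)))\<^sup>2"
        by (rule power_mono) simp
      also note young
      finally show ?thesis .
    qed
    have m_le: "(norm (ip f (m i)))\<^sup>2
        \<le> 2 * (norm (ip f (\<phi> i)))\<^sup>2 + 2 * (norm (ip f (\<phi> i - \<psi> i)))\<^sup>2" for f i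
    proof -
      have "norm (ip f (m i)) \<le> norm (ip f (\<phi> i)) + norm (ip f (\<phi> i - \<psi> i))"
        using norm_triangle_ineq4[of "ip f (\<phi> i)" "ip f (\<phi> i - \<psi> i)"]
        by (simp add: m_def ip_minus_right)
      then have "(norm (ip f (m i)))\<^sup>2 \<le> (norm (ip f (\<phi> i)) + norm (ip f (\<phi> i - \<psi> i)))\<^sup>2"
        by (rule power_mono) simp
      also have "\<dots> \<le> 2 * (norm (ip f (\<phi> i)))\<^sup>2 + 2 * (norm (ip f (\<phi> i - \<psi> i)))\<^sup>2"
        using sum_squares_bound[of "norm (ip f (\<phi> i))" "norm (ip f (\<phi> i - \<psi> i))"]
        by (simp add: power2_sum)
      finally show ?thesis .
    qed
    have "bessel_bound (2 * B + 2 * D) m"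
      unfolding bessel_bound_def
    proof (intro conjI allI impI)
      show "0 \<le> 2 * B + 2 * D" using AB \<open>0 \<le> D\<close> by simp
      fix f and F :: "'i set" assume "finite F"
      have "(\<Sum>i\<in>F. (norm (ip f (m i)))\<^sup>2)
          \<le> 2 * (\<Sum>i\<in>F. (norm (ip f (\<phi> i)))\<^sup>2) + 2 * (\<Sum>i\<in>F. (norm (ip f (\<phi> i - \<psi> i)))\<^sup>2)"
        using sum_mono[of F, OF m_le] by (simp add: sum.distrib sum_distrib_left)
      also have "\<dots> \<le> 2 * (B * (norm f)\<^sup>2) + 2 * (D * (norm f)\<^sup>2)"
        using \<open>finite F\<close> bessel_boundD(2)[OF frame_imp_bessel_bound[OF frame]] bessel_boundD(2)[OF diff]
        by (intro add_mono mult_left_mono) auto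
      finally show "(\<Sum>i\<in>F. (norm (ip f (m i)))\<^sup>2) \<le> (2 * B + 2 * D) * (norm f)\<^sup>2"
        by (simp add: algebra_simps)
    qed
    note m = bessel_boundD[OF this]
    note d = bessel_boundD[OF diff]
    have "A' * (norm f)\<^sup>2 \<le> (\<Sum>\<^sub>\<infinity>i. (norm (ip f (m i)))\<^sup>2)" for f
    proof -
      have "A * (norm f)\<^sup>2 \<le> (\<Sum>\<^sub>\<infinity>i. (norm (ip f (\<phi> i)))\<^sup>2)"
        using frame by (simp add: frame_with_bounds_def)
      also have "\<dots> \<le> (\<Sum>\<^sub>\<infinity>i. (1 + t) * (norm (ip f (m i)))\<^sup>2 + (1 + 1 / t) * (norm (ip f (\<phi> i - \<psi> i)))\<^sup>2)"
        using frame
        by (intro infsum_mono le_m summable_on_add summable_on_cmult_right m d)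
          (simp add: frame_with_bounds_def)
      also have "\<dots> = (1 + t) * (\<Sum>\<^sub>\<infinity>i. (norm (ip f (m i)))\<^sup>2)
          + (1 + 1 / t) * (\<Sum>\<^sub>\<infinity>i. (norm (ip f (\<phi> i - \<psi> i)))\<^sup>2)"
        by (subst infsum_add) (simp_all add: summable_on_cmult_right m d infsum_cmult_right)
      also have "\<dots> \<le> (1 + t) * (\<Sum>\<^sub>\<infinity>i. (norm (ip f (m i)))\<^sup>2) + (1 + 1 / t) * (D * (norm f)\<^sup>2)"
        using \<open>t \<ge> 1\<close> by (intro add_left_mono mult_left_mono d) simp
      finally have "(A - (1 + 1 / t) * D) * (norm f)\<^sup>2 \<le> (1 + t) * (\<Sum>\<^sub>\<infinity>i. (norm (ip f (m i)))\<^sup>2)"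
        by (simp add: algebra_simps)
      then show ?thesis
        using \<open>t \<ge> 1\<close> by (simp add: A'_def divide_le_eq mult.commute)
    qed
    then show ?thesis
      unfolding frame_with_bounds_def m_def[symmetric]
      using \<open>A' > 0\<close> \<open>A' \<le> A\<close> AB \<open>0 \<le> D\<close> m by auto
  qed
  then show ?thesis unfolding woven_def by blast
qed

end

end

section \<open>The one-parameter family of approximate duals\<close>

text \<open>The factor interpolates between \<open>r\<close> at \<open>c = 1\<close> and 1 at
  \<open>c = 0\<close>. It is applied to both T* and V.\<close>

lemma norm_diff_scaleR_le:
  fixes x y :: "'a::real_normed_vector"
  assumes "norm (x - y) \<le> r * norm x" "0 \<le> c" "c \<le> 1"
  shows "norm (x - c *\<^sub>R y) \<le> (c * r + (1 - c)) * norm x"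
proof -
  have "x - c *\<^sub>R y = c *\<^sub>R (x - y) + (1 - c) *\<^sub>R x" by (simp add: algebra_simps)
  then have "norm (x - c *\<^sub>R y) \<le> c * norm (x - y) + (1 - c) * norm x"
    using norm_triangle_ineq[of "c *\<^sub>R (x - y)" "(1 - c) *\<^sub>R x"] assms(2,3) by simp
  also have "\<dots> \<le> c * (r * norm x) + (1 - c) * norm x"
    using assms by (intro add_right_mono mult_left_mono)
  finally show ?thesis by (simp add: algebra_simps)
qed

theorem proposition3p2:
  fixes smul :: "'k::hilbert_scalar \<Rightarrow> 'a::banach \<Rightarrow> 'a"
    and ip :: "'a \<Rightarrow> 'a \<Rightarrow> 'k"
    and \<phi> :: "'i::countable \<Rightarrow> 'a"
    and A\<phi> B\<phi> :: real
    and T :: "'a \<Rightarrow> 'a"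
  assumes "hilbert_space smul ip"
    and "separable_space (euclidean :: 'a topology)"
    and "\<exists>x::'a. x \<noteq> 0"
    and "redundant_frame_with_bounds smul ip A\<phi> B\<phi> \<phi>"
    and "bounded_operator smul T"
    and "onorm (\<lambda>f. f - T f) < 1"
    and "(onorm (\<lambda>f. f - hilbert_adjoint ip T (inv (frame_operator smul ip \<phi>) f)))\<^sup>2 < A\<phi> / B\<phi>"
  shows "infinite {\<psi> :: 'i \<Rightarrow> 'a. approximate_dual smul ip \<phi> \<psi> \<and> woven ip \<phi> \<psi>}"
proof -
  interpret hilbert_space smul ip by fact
  have frame: "frame_with_bounds ip A\<phi> B\<phi> \<phi>"
    using assms(4) by (simp add: redundant_frame_with_bounds_def)
  then have AB: "0 < A\<phi>" "A\<phi> \<le> B\<phi>" by (auto simp: frame_with_bounds_def)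
  note bessel = frame_imp_bessel_bound[OF frame]
  define S where "S = frame_operator smul ip \<phi>"
  define T' where "T' = hilbert_adjoint ip T"
  define V where "V = (\<lambda>f. T' (inv S f))"
  have T': "bounded_operator smul T'"
    unfolding T'_def by (rule hilbert_adjoint(1)[OF frame assms(5)])
  have V: "bounded_operator smul V"
    unfolding V_def S_def
    by (rule bounded_operator_compose[OF T' bounded_operator_inv_frame_operator[OF frame]])
  define r where "r = onorm (\<lambda>f. f - T f)"
  have T'_le: "norm (f - T' f) \<le> r * norm f" for f
    unfolding T'_def r_def by (rule norm_diff_hilbert_adjoint_le[OF frame assms(5)])
  have "r < 1" using assms(6) by (simp add: r_def)
  define \<nu> where "\<nu> = onorm (\<lambda>f. f - V f)"
  have bl: "bounded_linear (\<lambda>f. f - V f)" by (rule bounded_operatorD(3)[OF bounded_operator_diff_id[OF V]])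
  have V_le: "norm (f - V f) \<le> \<nu> * norm f" for f
    unfolding \<nu>_def using bl by (rule onorm)
  have "0 \<le> \<nu>" unfolding \<nu>_def using bl by (rule onorm_pos_le)
  define q where "q = sqrt (A\<phi> / B\<phi>)"
  have "\<nu>\<^sup>2 < A\<phi> / B\<phi>" using assms(7) by (simp add: \<nu>_def V_def T'_def S_def)
  then have "\<nu> < q" unfolding q_def by (rule real_less_rsqrt)
  define \<psi> where "\<psi> = (\<lambda>c i. c *\<^sub>R V (\<phi> i))"
  have dual: "mixed_frame_operator (\<psi> c) \<phi> f = c *\<^sub>R T' f" for c f
  proof -
    have "mixed_frame_operator (\<psi> c) \<phi> f = c *\<^sub>R V (mixed_frame_operator \<phi> \<phi> f)"
      unfolding \<psi>_def
      by (rule synthesis_image[OF bessel _ bounded_operator_scaleR[OF V]])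
        (simp add: analysis_def bessel_boundD(3)[OF bessel])
    then show ?thesis
      by (simp add: V_def S_def frame_operator_inv[OF frame] flip: frame_operator_def)
  qed
  \<comment> \<open>Since \<open>c * \<nu> + (1 - c) \<le> \<nu> + (1 - c)\<close>, the condition
    \<open>1 - c < q - \<nu>\<close> keeps this factor below \<open>q\<close>. The maximum with 0
    gives \<open>0 < c\<close>, which makes \<open>c * r + (1 - c) < 1\<close> strict.\<close>
  have good: "approximate_dual smul ip \<phi> (\<psi> c) \<and> woven ip \<phi> (\<psi> c)"
    if c: "max 0 (1 - (q - \<nu>)) < c" "c < 1" for c
  proof
    have c01: "0 < c" "c \<le> 1" using c by auto
    have cV: "bounded_operator smul (\<lambda>f. c *\<^sub>R V f)" by (rule bounded_operator_scaleR[OF V])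
    show "approximate_dual smul ip \<phi> (\<psi> c)"
      unfolding approximate_dual_def dual
    proof
      show "bessel_sequence ip (\<psi> c)"
        unfolding \<psi>_def
        by (rule bessel_bound_imp_bessel_sequence,
            rule bessel_bound_image[OF bessel cV onorm[OF bounded_operatorD(3)[OF cV]]])
      have "0 \<le> r" unfolding r_def
        by (rule onorm_pos_le, rule bounded_operatorD(3)[OF bounded_operator_diff_id[OF assms(5)]])
      have "onorm (\<lambda>f. f - c *\<^sub>R T' f) \<le> c * r + (1 - c)"
      proof (rule onorm_bound)
        show "0 \<le> c * r + (1 - c)" using c01 \<open>0 \<le> r\<close> by simp
        show "norm (f - c *\<^sub>R T' f) \<le> (c * r + (1 - c)) * norm f" for f
          using norm_diff_scaleR_le[OF T'_le] c01 by simp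
      qed
      also have "\<dots> < 1" using mult_strict_left_mono[OF \<open>r < 1\<close> c01(1)] by simp
      finally show "onorm (\<lambda>f. f - c *\<^sub>R T' f) < 1" .
    qed
    define K where "K = c * \<nu> + (1 - c)"
    have "0 \<le> K" using c01 \<open>0 \<le> \<nu>\<close> by (simp add: K_def)
    have "c * \<nu> \<le> \<nu>" using c01 \<open>0 \<le> \<nu>\<close> by (simp add: mult_left_le_one_le)
    then have "K < q" using c by (simp add: K_def)
    then have "K\<^sup>2 < q\<^sup>2" using \<open>0 \<le> K\<close> by (simp add: power_strict_mono)
    then have "K\<^sup>2 * B\<phi> < A\<phi>" using AB by (simp add: q_def field_simps)
    \<comment> \<open>The differences are the images of the frame under I - c V, whose norm is at
      most \<open>K\<close>.\<close>
    moreover have "bessel_bound (K\<^sup>2 * B\<phi>) (\<lambda>i. \<phi> i - \<psi> c i)"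
      unfolding \<psi>_def K_def
      by (rule bessel_bound_image[OF bessel bounded_operator_diff_id[OF cV]],
          rule norm_diff_scaleR_le[OF V_le]) (use c01 in auto)
    ultimately show "woven ip \<phi> (\<psi> c)"
      by (intro woven_of_small_perturbation[OF frame])
  qed
  obtain x :: 'a where "x \<noteq> 0" using assms(3) by blast
  \<comment> \<open>A nonzero vector is required here; it lets \<open>c\<close> be recovered from
    the operator \<open>c T'\<close> of the pair.\<close>
  have "T' x \<noteq> 0"
  proof
    assume "T' x = 0"
    then have "norm x \<le> r * norm x" using T'_le[of x] by simp
    then show False using \<open>r < 1\<close> \<open>x \<noteq> 0\<close> by simp
  qed
  have "inj \<psi>"
  proof (rule injI)
    fix c d assume "\<psi> c = \<psi> d"
    then have "c *\<^sub>R T' x = d *\<^sub>R T' x" by (metis dual)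
    then show "c = d" using \<open>T' x \<noteq> 0\<close> by simp
  qed
  then have "infinite (\<psi> ` {max 0 (1 - (q - \<nu>))<..<1})"
    using \<open>\<nu> < q\<close> by (subst finite_image_iff) (auto intro: inj_on_subset simp: infinite_Ioo_iff)
  moreover have "\<psi> ` {max 0 (1 - (q - \<nu>))<..<1}
      \<subseteq> {\<psi>. approximate_dual smul ip \<phi> \<psi> \<and> woven ip \<phi> \<psi>}"
    using good by auto
  ultimately show ?thesis by (meson finite_subset)
qed

end
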